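(* Let $B\in SL_n(\mathbb{F}_q)$. Then $$\mathrm{Im}(\partial\mathrm{char}_B)=\left\{\frac{\mathrm{char}(B)}{\min(B)}\,b:\ b\in\mathbb{F}_q[x],\ \deg b<\deg\min(B),\ b(0)=0\right\}.$$
   Context: $q$ is a power of an odd prime. $\mathfrak{sl}_n(\mathbb{F}_q)=\{X\in M_n(\mathbb{F}_q):\mathrm{tr}(X)=0\}$. $\mathrm{char}(B)=\det(xI-B)$ and $\min(B)$ is the minimal polynomial of $B$. Here $\partial\mathrm{char}_B:\mathfrak{sl}_n(\mathbb{F}_q)\to\mathbb{F}_q[x]$ is the $\mathbb{F}_q$-linear map $B_1\mapsto\mathrm{tr}\big(\mathrm{Adj}(xI-B)\,B\,B_1\big)$, with $\mathrm{Adj}$ the adjugate matrix. *)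

theory Defs
  imports "Jordan_Normal_Form.Char_Poly" "HOL-Library.Cardinality"
    "HOL-Computational_Algebra.Primes"
begin

definition mat_trace :: "'a :: comm_monoid_add mat \<Rightarrow> 'a" where
  "mat_trace A = (\<Sum>i<dim_row A. A $$ (i, i))"

definition SL_mat :: "nat \<Rightarrow> 'a :: comm_ring_1 mat set" where
  "SL_mat n = {A \<in> carrier_mat n n. det A = 1}"

definition sl_mat :: "nat \<Rightarrow> 'a :: comm_ring_1 mat set" where
  "sl_mat n = {X \<in> carrier_mat n n. mat_trace X = 0}"

definition const_poly_mat :: "'a :: zero mat \<Rightarrow> 'a poly mat" where
  "const_poly_mat A = map_mat (\<lambda>a. [:a:]) A"

text \<open>The matrix \<open>f(A)\<close>. It is given entrywise because the type \<open>'a mat\<close> contains matrices of all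
  dimensions and hence is not an additive monoid over which one could sum.\<close>

definition poly_mat :: "'a :: comm_ring_1 poly \<Rightarrow> 'a mat \<Rightarrow> 'a mat" where
  "poly_mat f A = mat (dim_row A) (dim_row A)
     (\<lambda>(i, j). \<Sum>k\<le>degree f. coeff f k * (A ^\<^sub>m k) $$ (i, j))"

definition annihilates :: "'a :: comm_ring_1 poly \<Rightarrow> 'a mat \<Rightarrow> bool" where
  "annihilates f A \<longleftrightarrow> poly_mat f A = 0\<^sub>m (dim_row A) (dim_row A)"

definition is_min_poly :: "'a :: field mat \<Rightarrow> 'a poly \<Rightarrow> bool" where
  "is_min_poly A f \<longleftrightarrow> monic f \<and> annihilates f A \<and>
     (\<forall>g. g \<noteq> 0 \<longrightarrow> annihilates g A \<longrightarrow> degree f \<le> degree g)"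

definition min_poly :: "'a :: field mat \<Rightarrow> 'a poly" where
  "min_poly A = (THE f. is_min_poly A f)"

text \<open>Here \<open>char_poly_matrix B\<close> is \<open>xI - B\<close> and \<open>adj_mat\<close> is the adjugate.\<close>

definition dchar :: "'a :: comm_ring_1 mat \<Rightarrow> 'a mat \<Rightarrow> 'a poly" where
  "dchar B B\<^sub>1 = mat_trace (adj_mat (char_poly_matrix B) * const_poly_mat B * const_poly_mat B\<^sub>1)"


text \<open>Over a finite field the description in \<open>min_poly\<close> determines a unique polynomial.\<close>

lemma poly_mat_index:
  assumes "i < dim_row A" "j < dim_row A" "degree f \<le> m"
  shows "poly_mat f A $$ (i, j) = (\<Sum>k\<le>m. coeff f k * (A ^\<^sub>m k) $$ (i, j))"
proof -
  have "(\<Sum>k\<le>degree f. coeff f k * (A ^\<^sub>m k) $$ (i, j)) = (\<Sum>k\<le>m. coeff f k * (A ^\<^sub>m k) $$ (i, j))"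
    by (rule sum.mono_neutral_left) (use assms in \<open>auto simp: coeff_eq_0 not_le\<close>)
  then show ?thesis using assms by (simp add: poly_mat_def)
qed

lemma annihilates_iff:
  assumes "degree f \<le> m"
  shows "annihilates f A \<longleftrightarrow>
    (\<forall>i<dim_row A. \<forall>j<dim_row A. (\<Sum>k\<le>m. coeff f k * (A ^\<^sub>m k) $$ (i, j)) = 0)"
proof -
  have "annihilates f A \<longleftrightarrow> (\<forall>i<dim_row A. \<forall>j<dim_row A. poly_mat f A $$ (i, j) = 0)"
    unfolding annihilates_def by (auto simp: mat_eq_iff poly_mat_def)
  then show ?thesis using poly_mat_index[OF _ _ assms] by auto
qed

lemma annihilates_diff:
  assumes "annihilates f A" "annihilates g A"
  shows "annihilates (f - g) A"
proof -
  let ?m = "max (degree f) (degree g)"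
  have "degree (f - g) \<le> ?m" by (rule degree_diff_le) auto
  from annihilates_iff[OF this] show ?thesis
    using assms annihilates_iff[of f ?m A] annihilates_iff[of g ?m A]
    by (simp add: left_diff_distrib sum_subtractf)
qed

lemma annihilates_smult:
  fixes A :: "'a :: field mat"
  assumes "annihilates f A"
  shows "annihilates (Polynomial.smult c f) A"
  using assms annihilates_iff[of f "degree f" A] annihilates_iff[of "Polynomial.smult c f" "degree f" A]
  by (simp add: mult.assoc degree_smult_le flip: sum_distrib_left)

lemma annihilates_monom_diff:
  assumes "A \<in> carrier_mat n n" "A ^\<^sub>m a = A ^\<^sub>m b"
  shows "annihilates (monom 1 a - monom 1 b) A"
proof -
  have "degree (monom (1 :: 'a) a - monom 1 b) \<le> max a b"
    by (rule degree_diff_le) (auto intro: order.trans[OF degree_monom_le])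
  from annihilates_iff[OF this] show ?thesis
    using assms(2) by (simp add: left_diff_distrib sum_subtractf if_distrib[of "\<lambda>x. x * _"] sum.delta
        cong: if_cong)
qed

lemma finite_carrier_mat: "finite (carrier_mat n m :: 'a :: finite mat set)"
proof -
  let ?I = "{..<n} \<times> {..<m}"
  have "carrier_mat n m \<subseteq> mat n m ` (?I \<rightarrow>\<^sub>E (UNIV :: 'a set))"
  proof
    fix A :: "'a mat" assume "A \<in> carrier_mat n m"
    then have "A = mat n m (restrict (\<lambda>ij. A $$ ij) ?I)" by (intro eq_matI) auto
    then show "A \<in> mat n m ` (?I \<rightarrow>\<^sub>E UNIV)" by auto
  qed
  moreover have "finite (?I \<rightarrow>\<^sub>E (UNIV :: 'a set))" by (intro finite_PiE) auto
  ultimately show ?thesis by (meson finite_imageI finite_subset)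
qed

lemma ex_annihilates:
  fixes A :: "'a :: {field, finite} mat"
  assumes "A \<in> carrier_mat n n"
  shows "\<exists>f. f \<noteq> 0 \<and> annihilates f A"
proof -
  have "range (\<lambda>k. A ^\<^sub>m k) \<subseteq> carrier_mat n n" using assms by auto
  then have "finite (range (\<lambda>k. A ^\<^sub>m k))" using finite_carrier_mat finite_subset by blast
  then have "\<not> inj (\<lambda>k. A ^\<^sub>m k)" using finite_imageD infinite_UNIV_nat by blast
  then obtain a b where ab: "A ^\<^sub>m a = A ^\<^sub>m b" "a \<noteq> b" by (auto simp: inj_def)
  have "coeff (monom 1 a - monom 1 b :: 'a poly) a \<noteq> 0" using ab(2) by simp
  then have "monom 1 a - monom 1 b \<noteq> (0 :: 'a poly)" by force
  then show ?thesis using annihilates_monom_diff[OF assms ab(1)] by blast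
qed

lemma is_min_poly_unique:
  assumes f: "is_min_poly A f" and g: "is_min_poly A g"
  shows "f = g"
proof (rule ccontr)
  assume "f \<noteq> g"
  have "f \<noteq> 0" "g \<noteq> 0" using f g by (auto simp: is_min_poly_def)
  then have deg: "degree f = degree g" using f g by (auto simp: is_min_poly_def intro: le_antisym)
  have "annihilates (f - g) A" using f g annihilates_diff by (auto simp: is_min_poly_def)
  then have le: "degree f \<le> degree (f - g)" using f \<open>f \<noteq> g\<close> by (auto simp: is_min_poly_def)
  have "degree (f - g) \<le> degree f" using deg by (simp add: degree_diff_le)
  then have "degree (f - g) = degree f" using le by simp
  moreover have "coeff (f - g) (degree f) = 0" using f g deg by (simp add: is_min_poly_def)
  ultimately have "f - g = 0" by (metis leading_coeff_0_iff)
  then show False using \<open>f \<noteq> g\<close> by simp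
qed

lemma is_min_poly_min_poly:
  fixes A :: "'a :: {field, finite} mat"
  assumes "A \<in> carrier_mat n n"
  shows "is_min_poly A (min_poly A)"
proof -
  define P where "P f \<longleftrightarrow> f \<noteq> 0 \<and> annihilates f A" for f
  define f where "f = (ARG_MIN degree f. P f)"
  obtain f0 where "P f0" using ex_annihilates[OF assms] unfolding P_def by blast
  then have f: "P f" "\<And>g. P g \<Longrightarrow> degree f \<le> degree g"
    unfolding f_def by (blast intro: arg_min_natI arg_min_nat_le)+
  have "is_min_poly A (Polynomial.smult (inverse (lead_coeff f)) f)"
    using f unfolding P_def is_min_poly_def by (auto intro: annihilates_smult)
  then show ?thesis
    unfolding min_poly_def by (metis is_min_poly_unique theI)
qed

end

theory Submission
  imports Defs
begin

text \<open>
  Let \<open>m\<close> be the minimal polynomial of \<open>B\<close>, of degree \<open>d\<close>, and let \<open>M(x, y) = (m(x) - m(y)) / (x - y)\<close>.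
  Since \<open>m(B) = 0\<close>, we have \<open>M(x, B) (xI - B) = m(x) I\<close>, so the adjugate of \<open>xI - B\<close> is
  \<open>char(B) / m\<close> times \<open>M(x, B)\<close>. The coefficient of \<open>x\<^sup>k\<close> in \<open>M(x, B)\<close> is \<open>N\<^sub>k = m\<^sub>k(B)\<close>, where
  \<open>m\<^sub>k\<close> arises from \<open>m\<close> by dropping the lowest \<open>k + 1\<close> coefficients and dividing by \<open>x\<^bsup>k+1\<^esup>\<close>.
  Thus \<open>B\<^sub>1\<close> is mapped to \<open>char(B) / m\<close> times the polynomial with coefficients \<open>tr(N\<^sub>k B B\<^sub>1)\<close>, \<open>k < d\<close>.
  Because \<open>N\<^sub>0 B = - m(0) I\<close> with \<open>m(0) \<noteq> 0\<close>, the constant coefficient vanishes exactly when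
  \<open>tr(B\<^sub>1) = 0\<close>. By minimality of \<open>m\<close> and invertibility of \<open>B\<close> the matrices \<open>N\<^sub>k B\<close> are linearly
  independent, so all values of these \<open>d\<close> functionals are attained.
\<close>

section \<open>Entries and traces of products, and cancellation of an invertible factor\<close>

lemma mult_mat_index:
  assumes "A \<in> carrier_mat m l" "C \<in> carrier_mat l n" "i < m" "j < n"
  shows "(A * C) $$ (i, j) = (\<Sum>k<l. A $$ (i, k) * C $$ (k, j))"
  using assms by (simp add: scalar_prod_def atLeast0LessThan)

lemma mat_trace_mult:
  assumes "A \<in> carrier_mat n n" "C \<in> carrier_mat n n"
  shows "mat_trace (A * C) = (\<Sum>(i, j)\<in>{..<n} \<times> {..<n}. A $$ (i, j) * C $$ (j, i))"
proof -
  have "mat_trace (A * C) = (\<Sum>i<n. \<Sum>j<n. A $$ (i, j) * C $$ (j, i))"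
    unfolding mat_trace_def using assms
    by (auto intro!: sum.cong simp: mult_mat_index[OF assms] simp del: index_mult_mat(1))
  then show ?thesis by (simp add: sum.cartesian_product)
qed

lemma mat_trace_smult: "mat_trace (c \<cdot>\<^sub>m A) = c * mat_trace A"
  if "A \<in> carrier_mat n n" for A :: "'a :: comm_ring_1 mat"
  using that by (auto simp: mat_trace_def sum_distrib_left)

text \<open>Multiplying \<open>A * B = 0\<close> on the right by the adjugate of \<open>B\<close>
  gives \<open>det B\<close> times \<open>A\<close>.\<close>

lemma mult_mat_right_eq_0D:
  fixes A B :: "'a :: field mat"
  assumes A: "A \<in> carrier_mat n n" and B: "B \<in> carrier_mat n n" and det: "det B \<noteq> 0"
    and AB: "A * B = 0\<^sub>m n n"
  shows "A = 0\<^sub>m n n"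
proof -
  note adj = adj_mat[OF B]
  have "det B \<cdot>\<^sub>m A = A * (B * adj_mat B)"
    unfolding adj(2) mult_smult_distrib[OF A one_carrier_mat] using A by simp
  also have "\<dots> = 0\<^sub>m n n"
    using assoc_mult_mat[OF A B adj(1)] adj(1) AB by simp
  finally have *: "det B \<cdot>\<^sub>m A = 0\<^sub>m n n" .
  show ?thesis
  proof (rule eq_matI)
    fix i j assume "i < dim_row (0\<^sub>m n n :: 'a mat)" "j < dim_col (0\<^sub>m n n :: 'a mat)"
    then show "A $$ (i, j) = 0\<^sub>m n n $$ (i, j)"
      using arg_cong[OF *, of "\<lambda>X. X $$ (i, j)"] A det by simp
  qed (use A in auto)
qed

subsection \<open>Polynomials evaluated at a matrix\<close>

lemma poly_mat_carrier [simp]: "A \<in> carrier_mat n n \<Longrightarrow> poly_mat f A \<in> carrier_mat n n"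
  by (simp add: poly_mat_def)

lemma dim_poly_mat [simp]:
  "dim_row (poly_mat f A) = dim_row A" "dim_col (poly_mat f A) = dim_row A"
  by (simp_all add: poly_mat_def)

lemma poly_mat_0: "A \<in> carrier_mat n n \<Longrightarrow> poly_mat 0 A = 0\<^sub>m n n"
  by (intro eq_matI) (auto simp: poly_mat_def)

lemma poly_mat_add:
  assumes "A \<in> carrier_mat n n"
  shows "poly_mat (f + g) A = poly_mat f A + poly_mat g A"
proof (rule eq_matI)
  fix i j assume ij: "i < dim_row (poly_mat f A + poly_mat g A)" "j < dim_col (poly_mat f A + poly_mat g A)"
  let ?m = "max (degree f) (degree g)"
  have "degree (f + g) \<le> ?m" by (rule degree_add_le) auto
  with ij show "poly_mat (f + g) A $$ (i, j) = (poly_mat f A + poly_mat g A) $$ (i, j)"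
    using assms by (simp add: poly_mat_index[where m = ?m] distrib_right sum.distrib)
qed (use assms in \<open>auto simp: poly_mat_def\<close>)

lemma poly_mat_smult:
  assumes "A \<in> carrier_mat n n"
  shows "poly_mat (Polynomial.smult c f) A = c \<cdot>\<^sub>m poly_mat f A"
  using assms
  by (intro eq_matI)
    (auto simp: poly_mat_index[where m = "degree f"] degree_smult_le mult.assoc sum_distrib_left)

lemma poly_mat_sum_index:
  fixes d :: nat
  assumes "A \<in> carrier_mat n n" "i < n" "j < n"
  shows "poly_mat (\<Sum>k<d. Polynomial.smult (c k) (f k)) A $$ (i, j)
    = (\<Sum>k<d. c k * poly_mat (f k) A $$ (i, j))"
proof (induction d)
  case 0
  show ?case using assms by (simp add: poly_mat_0)
next
  case (Suc d)
  then show ?case using assms by (simp add: poly_mat_add poly_mat_smult)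
qed

lemma poly_mat_pCons:
  assumes A: "A \<in> carrier_mat n n"
  shows "poly_mat (pCons c f) A = c \<cdot>\<^sub>m 1\<^sub>m n + poly_mat f A * A"
proof (rule eq_matI)
  fix i j assume "i < dim_row (c \<cdot>\<^sub>m 1\<^sub>m n + poly_mat f A * A)" "j < dim_col (c \<cdot>\<^sub>m 1\<^sub>m n + poly_mat f A * A)"
  then have ij: "i < n" "j < n" using A by auto
  have "poly_mat (pCons c f) A $$ (i, j)
      = (\<Sum>k\<le>Suc (degree f). coeff (pCons c f) k * (A ^\<^sub>m k) $$ (i, j))"
    by (rule poly_mat_index) (use A ij in \<open>auto simp: degree_pCons_le\<close>)
  also have "\<dots> = c * 1\<^sub>m n $$ (i, j) + (\<Sum>k\<le>degree f. coeff f k * (A ^\<^sub>m k * A) $$ (i, j))"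
    using A by (subst sum.atMost_Suc_shift) simp
  also have "(\<Sum>k\<le>degree f. coeff f k * (A ^\<^sub>m k * A) $$ (i, j))
      = (\<Sum>k\<le>degree f. \<Sum>l<n. coeff f k * (A ^\<^sub>m k) $$ (i, l) * A $$ (l, j))"
    using mult_mat_index[OF pow_carrier_mat[OF A] A ij]
    by (simp add: sum_distrib_left mult.assoc del: index_mult_mat)
  also have "\<dots> = (\<Sum>l<n. poly_mat f A $$ (i, l) * A $$ (l, j))"
    by (subst sum.swap) (use A ij in \<open>simp add: poly_mat_def sum_distrib_right\<close>)
  also have "\<dots> = (poly_mat f A * A) $$ (i, j)"
    using mult_mat_index[OF poly_mat_carrier[OF A] A ij] by simp
  finally show "poly_mat (pCons c f) A $$ (i, j) = (c \<cdot>\<^sub>m 1\<^sub>m n + poly_mat f A * A) $$ (i, j)"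
    using A ij by simp
qed (use A in \<open>auto simp: poly_mat_def\<close>)

text \<open>Induction on \<open>f\<close>: the product with \<open>pCons a f\<close> is
  \<open>a\<close> times \<open>g\<close> plus x times \<open>f * g\<close>, and by
  \<open>poly_mat_pCons\<close> multiplying by x means multiplying by \<open>A\<close> on the
  right.\<close>

lemma annihilates_mult:
  assumes A: "A \<in> carrier_mat n n" and g: "annihilates g A"
  shows "annihilates (f * g) A"
proof (induction f)
  case 0
  show ?case using A by (simp add: annihilates_def poly_mat_0)
next
  case (pCons a f)
  have "0 \<cdot>\<^sub>m 1\<^sub>m n = (0\<^sub>m n n :: 'a mat)" by (intro eq_matI) auto
  then show ?case
    using pCons.IH A g
    by (simp add: annihilates_def poly_mat_add[OF A] poly_mat_smult[OF A] poly_mat_pCons[OF A])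
qed

lemma poly_shift_eq_pCons: "poly_shift k f = pCons (coeff f k) (poly_shift (Suc k) f)"
  by (auto simp: poly_eq_iff coeff_poly_shift coeff_pCons split: nat.splits)

lemma poly_shift_eq_0: "degree f < k \<Longrightarrow> poly_shift k f = 0"
  by (simp add: poly_eq_iff coeff_poly_shift coeff_eq_0)

text \<open>One step of the Horner scheme for f(A). The coefficients of a quotient by xI - A obey
  the same recursion, which is why \<open>poly_shift\<close> describes them.\<close>

lemma poly_mat_poly_shift:
  assumes "A \<in> carrier_mat n n"
  shows "poly_mat (poly_shift k f) A = coeff f k \<cdot>\<^sub>m 1\<^sub>m n + poly_mat (poly_shift (Suc k) f) A * A"
  by (subst poly_shift_eq_pCons) (rule poly_mat_pCons[OF assms])

subsection \<open>Matrices of polynomials\<close>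

text \<open>Allows a matrix of polynomials to be treated as a polynomial with matrix
  coefficients.\<close>

definition coeff_mat :: "nat \<Rightarrow> 'a :: zero poly mat \<Rightarrow> 'a mat" where
  "coeff_mat k P = map_mat (\<lambda>p. coeff p k) P"

lemma coeff_mat_carrier [simp]: "P \<in> carrier_mat m n \<Longrightarrow> coeff_mat k P \<in> carrier_mat m n"
  by (simp add: coeff_mat_def)

lemma const_poly_mat_carrier [simp]: "A \<in> carrier_mat m n \<Longrightarrow> const_poly_mat A \<in> carrier_mat m n"
  by (simp add: const_poly_mat_def)

lemma coeff_mat_mult_const:
  assumes P: "P \<in> carrier_mat m l" and A: "A \<in> carrier_mat l n"
  shows "coeff_mat k (P * const_poly_mat A) = coeff_mat k P * A"
proof (rule eq_matI)
  fix i j assume "i < dim_row (coeff_mat k P * A)" "j < dim_col (coeff_mat k P * A)"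
  then have ij: "i < m" "j < n" using assms by (auto simp: coeff_mat_def)
  have "coeff_mat k (P * const_poly_mat A) $$ (i, j) = coeff ((P * const_poly_mat A) $$ (i, j)) k"
    using ij P A by (simp add: coeff_mat_def const_poly_mat_def)
  also have "\<dots> = (\<Sum>r<l. coeff (P $$ (i, r)) k * A $$ (r, j))"
    unfolding mult_mat_index[OF P const_poly_mat_carrier[OF A] ij] using A ij
    by (simp add: const_poly_mat_def coeff_sum mult.commute)
  also have "\<dots> = (coeff_mat k P * A) $$ (i, j)"
    unfolding mult_mat_index[OF coeff_mat_carrier[OF P] A ij] using P ij by (simp add: coeff_mat_def)
  finally show "coeff_mat k (P * const_poly_mat A) $$ (i, j) = (coeff_mat k P * A) $$ (i, j)" .
qed (use assms in \<open>auto simp: coeff_mat_def const_poly_mat_def\<close>)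

lemma coeff_mat_trace: "coeff (mat_trace P) k = mat_trace (coeff_mat k P)" if "P \<in> carrier_mat n n"
  using that by (auto simp: mat_trace_def coeff_mat_def coeff_sum)

lemma coeff_mat_eqI:
  assumes "P \<in> carrier_mat m n" "Q \<in> carrier_mat m n" "\<And>k. coeff_mat k P = coeff_mat k Q"
  shows "P = Q"
proof (rule eq_matI)
  fix i j assume ij: "i < dim_row Q" "j < dim_col Q"
  show "P $$ (i, j) = Q $$ (i, j)"
  proof (rule poly_eqI)
    fix k
    show "coeff (P $$ (i, j)) k = coeff (Q $$ (i, j)) k"
      using arg_cong[OF assms(3)[of k], of "\<lambda>X. X $$ (i, j)"] assms(1,2) ij
      by (simp add: coeff_mat_def)
  qed
qed (use assms in auto)

lemma mult_char_poly_matrix: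
  assumes P: "P \<in> carrier_mat n n" and B: "B \<in> carrier_mat n n"
  shows "P * char_poly_matrix B = [:0, 1:] \<cdot>\<^sub>m P - P * const_poly_mat B"
proof -
  have eq: "char_poly_matrix B = [:0, 1:] \<cdot>\<^sub>m 1\<^sub>m n - const_poly_mat B"
    using B by (intro eq_matI) (auto simp: char_poly_matrix_def const_poly_mat_def)
  show ?thesis
    unfolding eq using P B
    by (subst mult_minus_distrib_mat[OF P]) (auto simp: mult_smult_distrib[OF P one_carrier_mat])
qed

lemma all_conv_0_Suc: "(\<forall>k. Q k) \<longleftrightarrow> Q 0 \<and> (\<forall>k. Q (Suc k))"
proof (intro iffI conjI allI)
  fix k assume "Q 0 \<and> (\<forall>k. Q (Suc k))"
  then show "Q k" by (cases k) auto
qed auto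

text \<open>Compare coefficients in xP - PB = fI. Multiplication by x shifts the index, so degree 0
  yields a boundary condition and degree k + 1 a recursion.\<close>

lemma mult_char_poly_matrix_eq_iff:
  assumes P: "P \<in> carrier_mat n n" and B: "B \<in> carrier_mat n n"
  shows "P * char_poly_matrix B = f \<cdot>\<^sub>m 1\<^sub>m n \<longleftrightarrow>
    0\<^sub>m n n = coeff f 0 \<cdot>\<^sub>m 1\<^sub>m n + coeff_mat 0 P * B \<and>
    (\<forall>k. coeff_mat k P = coeff f (Suc k) \<cdot>\<^sub>m 1\<^sub>m n + coeff_mat (Suc k) P * B)"
    (is "?L \<longleftrightarrow> ?R0 \<and> ?RS")
proof -
  let ?Q = "P * const_poly_mat B"
  have Q: "?Q \<in> carrier_mat n n" using P B by simp
  have entry: "coeff (?Q $$ (i, j)) k = (coeff_mat k P * B) $$ (i, j)" if "i < n" "j < n" for i j k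
    using arg_cong[OF coeff_mat_mult_const[OF P B, of k], of "\<lambda>X. X $$ (i, j)"] that P B
    by (simp add: coeff_mat_def const_poly_mat_def)
  have "?L \<longleftrightarrow> (\<forall>i<n. \<forall>j<n. pCons 0 (P $$ (i, j)) - ?Q $$ (i, j) = f * 1\<^sub>m n $$ (i, j))"
    unfolding mult_char_poly_matrix[OF P B] using P Q by (auto simp: mat_eq_iff)
  also have "\<dots> \<longleftrightarrow> (\<forall>i<n. \<forall>j<n. \<forall>k. coeff (pCons 0 (P $$ (i, j)) - ?Q $$ (i, j)) k
      = coeff (f * 1\<^sub>m n $$ (i, j)) k)"
    by (simp add: poly_eq_iff)
  also have "\<dots> \<longleftrightarrow> (\<forall>i<n. \<forall>j<n. \<forall>k. (case k of 0 \<Rightarrow> 0 | Suc k \<Rightarrow> coeff (P $$ (i, j)) k)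
      = coeff f k * 1\<^sub>m n $$ (i, j) + (coeff_mat k P * B) $$ (i, j))"
    using entry by (auto simp: coeff_pCons diff_eq_eq split: nat.split)
  also have "\<dots> \<longleftrightarrow> (\<forall>i<n. \<forall>j<n.
      0 = coeff f 0 * 1\<^sub>m n $$ (i, j) + (coeff_mat 0 P * B) $$ (i, j) \<and>
      (\<forall>k. coeff (P $$ (i, j)) k = coeff f (Suc k) * 1\<^sub>m n $$ (i, j) + (coeff_mat (Suc k) P * B) $$ (i, j)))"
    by (subst all_conv_0_Suc) simp
  also have "\<dots> \<longleftrightarrow> ?R0 \<and> ?RS"
  proof -
    have "?R0 \<longleftrightarrow> (\<forall>i<n. \<forall>j<n. 0 = coeff f 0 * 1\<^sub>m n $$ (i, j) + (coeff_mat 0 P * B) $$ (i, j))"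
      using P B by (simp add: mat_eq_iff coeff_mat_def)
    moreover have "?RS \<longleftrightarrow> (\<forall>i<n. \<forall>j<n. \<forall>k. coeff (P $$ (i, j)) k
        = coeff f (Suc k) * 1\<^sub>m n $$ (i, j) + (coeff_mat (Suc k) P * B) $$ (i, j))"
      using P B by (auto simp: mat_eq_iff coeff_mat_def)
    ultimately show ?thesis by blast
  qed
  finally show ?thesis .
qed

lemma coeff_mat_eventually_0:
  fixes P :: "'a :: comm_ring_1 poly mat"
  assumes P: "P \<in> carrier_mat m n"
  obtains K where "\<And>k. k \<ge> K \<Longrightarrow> coeff_mat k P = 0\<^sub>m m n"
proof -
  let ?D = "(\<lambda>(i, j). degree (P $$ (i, j))) ` ({..<m} \<times> {..<n})"
  have "degree (P $$ (i, j)) \<le> Max ?D" if "i < m" "j < n" for i j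
    by (rule Max_ge) (use that in force)+
  then have "coeff (P $$ (i, j)) k = 0" if "k \<ge> Suc (Max ?D)" "i < m" "j < n" for i j k
    using that by (intro coeff_eq_0) (meson Suc_le_lessD le_less_trans)
  then have "coeff_mat k P = 0\<^sub>m m n" if "k \<ge> Suc (Max ?D)" for k
    using P that by (intro eq_matI) (auto simp: coeff_mat_def)
  then show ?thesis using that by blast
qed

text \<open>The recursion computes each coefficient from the next higher one, and both sides vanish
  for large indices. Hence a left quotient of fI by xI - B is unique.\<close>

lemma coeff_mat_char_poly_quotient:
  fixes B :: "'a :: comm_ring_1 mat"
  assumes P: "P \<in> carrier_mat n n" and B: "B \<in> carrier_mat n n"
    and eq: "P * char_poly_matrix B = f \<cdot>\<^sub>m 1\<^sub>m n"
  shows "coeff_mat k P = poly_mat (poly_shift (Suc k) f) B"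
proof -
  obtain K where K: "\<And>k. k \<ge> K \<Longrightarrow> coeff_mat k P = 0\<^sub>m n n"
    using coeff_mat_eventually_0[OF P] by blast
  have rec: "coeff_mat k P = coeff f (Suc k) \<cdot>\<^sub>m 1\<^sub>m n + coeff_mat (Suc k) P * B" for k
    using eq mult_char_poly_matrix_eq_iff[OF P B] by blast
  \<comment> \<open>Downward induction on \<open>k\<close>, where \<open>d\<close> bounds the
    distance to the range in which both sides are zero.\<close>
  have "max K (degree f) \<le> k + d \<Longrightarrow> coeff_mat k P = poly_mat (poly_shift (Suc k) f) B" for d k
  proof (induction d arbitrary: k)
    case 0
    then show ?case using K poly_mat_0[OF B] by (simp add: poly_shift_eq_0)
  next
    case (Suc d)
    then have "coeff_mat (Suc k) P = poly_mat (poly_shift (Suc (Suc k)) f) B" by simp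
    then show ?case unfolding rec[of k] poly_mat_poly_shift[OF B, of "Suc k"] by simp
  qed
  from this[of k "max K (degree f)"] show ?thesis by simp
qed

text \<open>With the coefficients of \<open>P\<close> known, the boundary condition in degree 0 is
  the last Horner step and reads f(B) = 0.\<close>

lemma annihilates_if_char_poly_quotient:
  fixes B :: "'a :: comm_ring_1 mat"
  assumes P: "P \<in> carrier_mat n n" and B: "B \<in> carrier_mat n n"
    and eq: "P * char_poly_matrix B = f \<cdot>\<^sub>m 1\<^sub>m n"
  shows "annihilates f B"
proof -
  have "poly_mat f B = coeff f 0 \<cdot>\<^sub>m 1\<^sub>m n + coeff_mat 0 P * B"
    using poly_mat_poly_shift[OF B, of 0 f] coeff_mat_char_poly_quotient[OF assms, of 0] by simp
  also have "\<dots> = 0\<^sub>m n n" using eq mult_char_poly_matrix_eq_iff[OF P B, of f] by metis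
  finally show ?thesis using B by (simp add: annihilates_def)
qed

text \<open>The matrix \<open>M(x, B)\<close> for \<open>M(x, y) = (f(x) - f(y)) / (x - y)\<close>.\<close>

definition char_quotient :: "'a :: comm_ring_1 poly \<Rightarrow> 'a mat \<Rightarrow> 'a poly mat" where
  "char_quotient f B = mat (dim_row B) (dim_row B)
     (\<lambda>(i, j). \<Sum>k<degree f. monom (poly_mat (poly_shift (Suc k) f) B $$ (i, j)) k)"

lemma char_quotient_carrier [simp]: "B \<in> carrier_mat n n \<Longrightarrow> char_quotient f B \<in> carrier_mat n n"
  by (simp add: char_quotient_def)

lemma coeff_mat_char_quotient:
  assumes B: "B \<in> carrier_mat n n"
  shows "coeff_mat k (char_quotient f B) = poly_mat (poly_shift (Suc k) f) B"
proof (cases "k < degree f")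
  case True
  then show ?thesis using B
    by (intro eq_matI) (auto simp: coeff_mat_def char_quotient_def coeff_sum poly_mat_def)
next
  \<comment> \<open>Cutting the sum off at \<open>degree f\<close> loses nothing, since the later
    shifts of \<open>f\<close> are zero.\<close>
  case False
  then have "poly_mat (poly_shift (Suc k) f) B = 0\<^sub>m n n" 
    using poly_mat_0[OF B] by (simp add: poly_shift_eq_0)
  then show ?thesis using B False
    by (intro eq_matI) (auto simp: coeff_mat_def char_quotient_def coeff_sum)
qed

lemma char_quotient_mult:
  assumes B: "B \<in> carrier_mat n n" and f: "annihilates f B"
  shows "char_quotient f B * char_poly_matrix B = f \<cdot>\<^sub>m 1\<^sub>m n"
proof -
  have "poly_mat f B = 0\<^sub>m n n" using f B by (simp add: annihilates_def)
  then show ?thesis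
    unfolding mult_char_poly_matrix_eq_iff[OF char_quotient_carrier[OF B] B] coeff_mat_char_quotient[OF B]
    using poly_mat_poly_shift[OF B, of 0 f] by (intro conjI allI poly_mat_poly_shift[OF B]) simp
qed

subsection \<open>The minimal polynomial\<close>

text \<open>The adjugate of xI - B is itself a left quotient of char(B) I by xI - B.\<close>

lemma cayley_hamilton:
  fixes B :: "'a :: comm_ring_1 mat"
  assumes B: "B \<in> carrier_mat n n"
  shows "annihilates (char_poly B) B"
  using annihilates_if_char_poly_quotient[OF adj_mat(1) B adj_mat(3)] B
  unfolding char_poly_def by simp

text \<open>The remainder of \<open>f\<close> modulo \<open>m\<close> annihilates \<open>B\<close>
  and has too small a degree to be nonzero.\<close>

lemma is_min_poly_dvd:
  fixes B :: "'a :: field mat"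
  assumes B: "B \<in> carrier_mat n n" and m: "is_min_poly B m" and f: "annihilates f B"
  shows "m dvd f"
proof -
  have m0: "m \<noteq> 0" using m by (auto simp: is_min_poly_def)
  have "annihilates (f - f div m * m) B"
    by (intro annihilates_diff f annihilates_mult[OF B]) (use m in \<open>simp add: is_min_poly_def\<close>)
  then have "annihilates (f mod m) B" by (simp add: minus_div_mult_eq_mod)
  then have "f mod m = 0"
    using m degree_mod_less[OF m0, of f] by (auto simp: is_min_poly_def not_le[symmetric])
  then show ?thesis by (simp add: dvd_eq_mod_eq_0)
qed

lemma degree_is_min_poly_pos:
  assumes B: "B \<in> carrier_mat n n" and n: "n \<ge> 1" and m: "is_min_poly B m"
  shows "0 < degree m"
proof (rule ccontr)
  assume "\<not> 0 < degree m"
  then have "m = 1" using m degree_0_id[of m] by (simp add: is_min_poly_def one_pCons)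
  then have "poly_mat (pCons 1 0) B = 0\<^sub>m n n"
    using m B by (simp add: is_min_poly_def annihilates_def flip: one_pCons)
  then have "1 \<cdot>\<^sub>m 1\<^sub>m n = (0\<^sub>m n n :: 'a mat)"
    using B unfolding poly_mat_pCons[OF B] by (simp add: poly_mat_0)
  from arg_cong[OF this, of "\<lambda>X. X $$ (0, 0)"] show False using n by simp
qed

text \<open>Otherwise m = xq, and cancelling the invertible \<open>B\<close> in q(B) B = 0 gives an
  annihilating polynomial of smaller degree.\<close>

lemma is_min_poly_coeff_0:
  assumes B: "B \<in> carrier_mat n n" and det: "det B \<noteq> 0" and n: "n \<ge> 1" and m: "is_min_poly B m"
  shows "coeff m 0 \<noteq> 0"
proof
  assume c0: "coeff m 0 = 0"
  let ?q = "poly_shift 1 m"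
  have mq: "m = pCons 0 ?q" using poly_shift_eq_pCons[of 0 m] c0 by simp
  have q0: "?q \<noteq> 0" using mq m by (auto simp: is_min_poly_def)
  have "poly_mat ?q B * B = 0\<^sub>m n n"
  proof -
    have "0 \<cdot>\<^sub>m 1\<^sub>m n = (0\<^sub>m n n :: 'a mat)" by (intro eq_matI) auto
    then show ?thesis
      using poly_mat_poly_shift[OF B, of 0 m] m B c0
        left_add_zero_mat[OF mult_carrier_mat[OF poly_mat_carrier[OF B] B]]
      by (simp add: is_min_poly_def annihilates_def)
  qed
  then have "annihilates ?q B"
    using mult_mat_right_eq_0D[OF poly_mat_carrier[OF B] B det] B by (simp add: annihilates_def)
  then have "degree m \<le> degree ?q" using m q0 by (simp add: is_min_poly_def)
  moreover have "degree m = Suc (degree ?q)" using mq q0 by (metis degree_pCons_eq)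
  ultimately show False by simp
qed

text \<open>Both sides are left quotients of char(B) I by xI - B, so their coefficients agree by
  uniqueness.\<close>

lemma adj_char_poly_matrix:
  fixes B :: "'a :: field mat"
  assumes B: "B \<in> carrier_mat n n" and m: "is_min_poly B m"
  shows "adj_mat (char_poly_matrix B) = (char_poly B div m) \<cdot>\<^sub>m char_quotient m B"
proof (rule coeff_mat_eqI)
  let ?h = "char_poly B div m"
  note cB = char_poly_matrix_closed[OF B] and qB = char_quotient_carrier[OF B, of m]
  have ann: "annihilates m B" using m by (simp add: is_min_poly_def)
  have "(?h \<cdot>\<^sub>m char_quotient m B) * char_poly_matrix B = ?h \<cdot>\<^sub>m (m \<cdot>\<^sub>m 1\<^sub>m n)"
    unfolding char_quotient_mult[OF B ann, symmetric] by (rule mult_smult_assoc_mat[OF qB cB])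
  also have "\<dots> = (?h * m) \<cdot>\<^sub>m 1\<^sub>m n" by (intro eq_matI) auto
  also have "?h * m = char_poly B"
    using is_min_poly_dvd[OF B m cayley_hamilton[OF B]] by simp
  finally have eq: "(?h \<cdot>\<^sub>m char_quotient m B) * char_poly_matrix B = char_poly B \<cdot>\<^sub>m 1\<^sub>m n" .
  show "coeff_mat k (adj_mat (char_poly_matrix B)) = coeff_mat k (?h \<cdot>\<^sub>m char_quotient m B)" for k
    using coeff_mat_char_poly_quotient[OF smult_carrier_mat[OF qB] B eq]
      coeff_mat_char_poly_quotient[OF adj_mat(1)[OF cB] B adj_mat(3)[OF cB]]
    by (simp add: char_poly_def)
  show "adj_mat (char_poly_matrix B) \<in> carrier_mat n n" by (rule adj_mat(1)[OF cB])
  show "?h \<cdot>\<^sub>m char_quotient m B \<in> carrier_mat n n" using qB by simp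
qed

text \<open>As \<open>poly_shift (Suc k) m\<close> has degree \<open>degree m - 1 - k\<close>, the system for the \<open>c k\<close> is triangular.\<close>

lemma sum_smult_poly_shift_eq_0:
  fixes m :: "'a :: field poly"
  assumes m: "monic m" and g: "(\<Sum>k<degree m. Polynomial.smult (c k) (poly_shift (Suc k) m)) = 0"
    and k: "k < degree m"
  shows "c k = 0"
  using k
proof (induction k rule: less_induct)
  case (less k)
  let ?d = "degree m"
  have "0 = coeff (\<Sum>k<?d. Polynomial.smult (c k) (poly_shift (Suc k) m)) (?d - Suc k)"
    using g by simp
  also have "\<dots> = (\<Sum>j<?d. c j * coeff m (?d - Suc k + Suc j))"
    by (simp add: coeff_sum coeff_poly_shift)
  \<comment> \<open>The index of the coefficient of \<open>m\<close> is \<open>?d - k + j\<close>: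
    for j > k it exceeds the degree, for j = k it is the leading one, and for j < k the induction
    hypothesis gives \<open>c j = 0\<close>.\<close>
  also have "\<dots> = (\<Sum>j<?d. if j = k then c k else 0)"
  proof (rule sum.cong[OF refl])
    fix j assume "j \<in> {..<?d}"
    then show "c j * coeff m (?d - Suc k + Suc j) = (if j = k then c k else 0)"
      using less m by (cases j k rule: linorder_cases) (auto intro: coeff_eq_0)
  qed
  also have "\<dots> = c k" using less.prems by simp
  finally show ?case by simp
qed

subsection \<open>Prescribing values of independent functionals\<close>

text \<open>Induction on \<open>d\<close>: vectors dual to the first \<open>d\<close> functionals
  are used to build a vector \<open>e\<close> on which these vanish but the new one does not. A
  multiple of \<open>e\<close> then corrects the last value.\<close>

lemma ex_dual_vector:
  fixes v :: "nat \<Rightarrow> 'i \<Rightarrow> 'a :: field"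
  assumes S: "finite S"
    and indep: "\<And>c. (\<forall>s\<in>S. (\<Sum>k<d. c k * v k s) = 0) \<Longrightarrow> \<forall>k<d. c k = 0"
  shows "\<exists>w. \<forall>k<d. (\<Sum>s\<in>S. v k s * w s) = b k"
  using indep
proof (induction d arbitrary: b)
  case 0
  show ?case by simp
next
  case (Suc d)
  have indep': "\<forall>k<d. c k = 0" if "\<forall>s\<in>S. (\<Sum>k<d. c k * v k s) = 0" for c
  proof -
    have "\<forall>k<Suc d. (c(d := 0)) k = 0" by (rule Suc.prems) (use that in simp)
    then show ?thesis by (metis fun_upd_other less_Suc_eq less_irrefl)
  qed
  note IH = Suc.IH[OF indep']
  define br where "br k w = (\<Sum>s\<in>S. v k s * w s)" for k w
  have "\<exists>w. \<forall>k<d. br k w = (if k = j then 1 else 0)" for j unfolding br_def by (rule IH)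
  then obtain w where w: "\<And>j k. k < d \<Longrightarrow> br k (w j) = (if k = j then 1 else 0)" by metis
  \<comment> \<open>Pairing with the \<open>w j\<close> reads off coefficients, so these are the
    only ones with which \<open>v d\<close> could be a combination of the earlier
    \<open>v j\<close>. Independence excludes this.\<close>
  have "\<exists>s\<in>S. v d s - (\<Sum>j<d. br d (w j) * v j s) \<noteq> 0"
  proof (rule ccontr)
    assume *: "\<not> ?thesis"
    have "\<forall>k<Suc d. (\<lambda>j. if j = d then 1 else - br d (w j)) k = 0"
      by (rule Suc.prems) (use * in \<open>simp add: sum_negf\<close>)
    then show False by auto
  qed
  then obtain s where s: "s \<in> S" "v d s - (\<Sum>j<d. br d (w j) * v j s) \<noteq> 0" (is "?u \<noteq> 0") by blast
  \<comment> \<open>The unit vector at \<open>s\<close>, corrected by the \<open>w j\<close> so that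
    the first \<open>d\<close> functionals vanish. On it the new functional takes the value
    \<open>?u\<close>.\<close>
  define e where "e t = (if t = s then 1 else 0) - (\<Sum>j<d. v j s * w j t)" for t
  have br_e: "br k e = v k s - (\<Sum>j<d. v j s * br k (w j))" for k
  proof -
    have "br k e = (\<Sum>t\<in>S. if t = s then v k s else 0) - (\<Sum>t\<in>S. \<Sum>j<d. v j s * (v k t * w j t))"
      unfolding br_def e_def right_diff_distrib sum_subtractf sum_distrib_left
      by (intro arg_cong2[where f = minus] sum.cong) (auto simp: algebra_simps)
    also have "(\<Sum>t\<in>S. if t = s then v k s else 0) = v k s" using S s by simp
    also have "(\<Sum>t\<in>S. \<Sum>j<d. v j s * (v k t * w j t)) = (\<Sum>j<d. v j s * br k (w j))"
      unfolding br_def sum_distrib_left by (rule sum.swap)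
    finally show ?thesis .
  qed
  have e0: "br k e = 0" if "k < d" for k
    using that by (simp add: br_e w if_distrib cong: if_cong)
  have ed: "br d e = ?u" by (simp add: br_e mult.commute)
  obtain w' where w': "\<forall>k<d. br k w' = b k" using IH unfolding br_def by blast
  define a where "a = (b d - br d w') / ?u"
  have "br k (\<lambda>t. w' t + a * e t) = br k w' + a * br k e" for k
    by (simp add: br_def distrib_left sum.distrib sum_distrib_left algebra_simps)
  then have "br k (\<lambda>t. w' t + a * e t) = b k" if "k < Suc d" for k
    using that w' e0 ed s(2) by (cases "k = d") (auto simp: a_def)
  then show ?case unfolding br_def by (intro exI allI impI)
qed

subsection \<open>The image of the differential\<close>

lemma dchar_eq:
  fixes B :: "'a :: field mat"
  assumes B: "B \<in> carrier_mat n n" and C: "C \<in> carrier_mat n n" and m: "is_min_poly B m"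
  shows "dchar B C = char_poly B div m * mat_trace (char_quotient m B * const_poly_mat B * const_poly_mat C)"
proof -
  let ?h = "char_poly B div m" and ?M = "char_quotient m B"
  let ?B = "const_poly_mat B" and ?C = "const_poly_mat C"
  have M: "?M \<in> carrier_mat n n" and B': "?B \<in> carrier_mat n n" and C': "?C \<in> carrier_mat n n"
    using B C by auto
  have "(?h \<cdot>\<^sub>m ?M) * ?B * ?C = ?h \<cdot>\<^sub>m (?M * ?B * ?C)"
    unfolding mult_smult_assoc_mat[OF M B'] by (rule mult_smult_assoc_mat[OF mult_carrier_mat[OF M B'] C'])
  then show ?thesis
    unfolding dchar_def adj_char_poly_matrix[OF B m]
    using mat_trace_smult[OF mult_carrier_mat[OF mult_carrier_mat[OF M B'] C']] by simp
qed

lemma coeff_mat_trace_char_quotient: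
  assumes B: "B \<in> carrier_mat n n" and C: "C \<in> carrier_mat n n"
  shows "coeff (mat_trace (char_quotient m B * const_poly_mat B * const_poly_mat C)) k
    = mat_trace (poly_mat (poly_shift (Suc k) m) B * B * C)"
proof -
  have M: "char_quotient m B * const_poly_mat B \<in> carrier_mat n n"
    using B by (intro mult_carrier_mat[where n = n]) simp_all
  have MC: "char_quotient m B * const_poly_mat B * const_poly_mat C \<in> carrier_mat n n" using M C by auto
  show ?thesis
    unfolding coeff_mat_trace[OF MC] coeff_mat_mult_const[OF M C]
      coeff_mat_mult_const[OF char_quotient_carrier[OF B] B] coeff_mat_char_quotient[OF B] ..
qed

text \<open>The last Horner step for m(B) = 0 shows that \<open>?X\<close> is a scalar matrix. This
  links the trace of \<open>C\<close> to the constant coefficient.\<close>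

lemma mat_trace_shift_1:
  fixes B :: "'a :: comm_ring_1 mat"
  assumes B: "B \<in> carrier_mat n n" and C: "C \<in> carrier_mat n n" and m: "annihilates m B"
  shows "mat_trace (poly_mat (poly_shift (Suc 0) m) B * B * C) = - coeff m 0 * mat_trace C"
proof -
  let ?X = "poly_mat (poly_shift (Suc 0) m) B * B"
  have X: "?X \<in> carrier_mat n n" using B by auto
  have eq: "0\<^sub>m n n = coeff m 0 \<cdot>\<^sub>m 1\<^sub>m n + ?X"
    using poly_mat_poly_shift[OF B, of 0 m] m B by (simp add: annihilates_def)
  have "?X = (- coeff m 0) \<cdot>\<^sub>m 1\<^sub>m n"
  proof (rule eq_matI)
    fix i j assume "i < dim_row ((- coeff m 0) \<cdot>\<^sub>m 1\<^sub>m n)" "j < dim_col ((- coeff m 0) \<cdot>\<^sub>m 1\<^sub>m n)"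
    then have ij: "i < n" "j < n" by auto
    then have "0 = coeff m 0 * 1\<^sub>m n $$ (i, j) + ?X $$ (i, j)"
      using arg_cong[OF eq, of "\<lambda>X. X $$ (i, j)"] X carrier_matD[OF X]
      by (simp del: index_mult_mat index_one_mat(1))
    then show "?X $$ (i, j) = ((- coeff m 0) \<cdot>\<^sub>m 1\<^sub>m n) $$ (i, j)"
      using ij by (simp add: eq_neg_iff_add_eq_0 add.commute del: index_mult_mat(1) index_one_mat(1))
  qed (use X in auto)
  then have "?X * C = (- coeff m 0) \<cdot>\<^sub>m C"
    using mult_smult_assoc_mat[OF one_carrier_mat C] C by simp
  then show ?thesis using mat_trace_smult[OF C] by simp
qed

theorem theorem7p1:
  fixes B :: "'a :: {field, finite} mat" and n p k :: nat
  assumes "prime p" and "odd p" and "k \<ge> 1" and "CARD('a) = p ^ k"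
    and "n \<ge> 1" and "B \<in> SL_mat n"
  shows "dchar B ` sl_mat n =
    {char_poly B div min_poly B * b | b. degree b < degree (min_poly B) \<and> poly b 0 = 0}"
proof -
  have B: "B \<in> carrier_mat n n" and det: "det B \<noteq> 0" using assms(6) by (auto simp: SL_mat_def)
  define m where "m = min_poly B"
  have m: "is_min_poly B m" unfolding m_def by (rule is_min_poly_min_poly[OF B])
  have monic: "monic m" and ann: "annihilates m B" using m by (auto simp: is_min_poly_def)
  define d where "d = degree m"
  have d: "d > 0" unfolding d_def by (rule degree_is_min_poly_pos[OF B assms(5) m])
  have m0: "coeff m 0 \<noteq> 0" by (rule is_min_poly_coeff_0[OF B det assms(5) m])
  let ?S = "{..<n} \<times> {..<n}"
  define N where "N k = poly_mat (poly_shift (Suc k) m) B" for k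
  have N: "N k \<in> carrier_mat n n" for k unfolding N_def using B by simp
  have NB: "N k * B \<in> carrier_mat n n" for k by (rule mult_carrier_mat[OF N B])
  \<comment> \<open>The cofactor of char(B) / m in \<open>dchar B C\<close>; it remains to find the
    image of \<open>b\<close>.\<close>
  define b where "b C = mat_trace (char_quotient m B * const_poly_mat B * const_poly_mat C)" for C
  have dchar: "dchar B C = char_poly B div m * b C" if "C \<in> carrier_mat n n" for C
    unfolding b_def by (rule dchar_eq[OF B that m])
  have coeff_b: "coeff (b C) k = mat_trace (N k * B * C)" if "C \<in> carrier_mat n n" for C k
    unfolding b_def N_def by (rule coeff_mat_trace_char_quotient[OF B that])
  have coeff_b_0: "coeff (b C) 0 = - coeff m 0 * mat_trace C" if "C \<in> carrier_mat n n" for C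
    unfolding coeff_b[OF that] N_def by (rule mat_trace_shift_1[OF B that ann])
  have coeff_b_ge: "coeff (b C) k = 0" if C: "C \<in> carrier_mat n n" and k: "k \<ge> d" for C k
  proof -
    have "N k = 0\<^sub>m n n"
      using k poly_mat_0[OF B] by (simp add: N_def d_def poly_shift_eq_0)
    then show ?thesis using B C by (simp add: coeff_b[OF C] mat_trace_def)
  qed
  have indep: "\<forall>k<d. c k = 0" if c: "\<forall>s\<in>?S. (\<Sum>k<d. c k * (N k * B) $$ s) = 0" for c
  proof -
    \<comment> \<open>A linear relation among the \<open>N k * B\<close> says that g(B) B = 0 with
      \<open>g\<close> of degree below \<open>d\<close>, so minimality of \<open>m\<close> forces
      \<open>g = 0\<close>.\<close>
    define g where "g = (\<Sum>k<d. Polynomial.smult (c k) (poly_shift (Suc k) m))"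
    have "poly_mat g B * B = 0\<^sub>m n n"
    proof (rule eq_matI)
      fix i j assume "i < dim_row (0\<^sub>m n n :: 'a mat)" "j < dim_col (0\<^sub>m n n :: 'a mat)"
      then have ij: "i < n" "j < n" by auto
      have "(poly_mat g B * B) $$ (i, j) = (\<Sum>l<n. \<Sum>k<d. c k * (N k $$ (i, l) * B $$ (l, j)))"
        unfolding mult_mat_index[OF poly_mat_carrier[OF B] B ij] using ij
        by (simp add: g_def N_def poly_mat_sum_index[OF B] sum_distrib_right mult.assoc)
      also have "\<dots> = (\<Sum>k<d. c k * (N k * B) $$ (i, j))"
        unfolding mult_mat_index[OF N B ij] sum_distrib_left by (rule sum.swap)
      also have "\<dots> = 0" using c ij by blast
      finally show "(poly_mat g B * B) $$ (i, j) = 0\<^sub>m n n $$ (i, j)" using ij by simp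
    qed (use B in auto)
    then have "poly_mat g B = 0\<^sub>m n n"
      by (rule mult_mat_right_eq_0D[OF poly_mat_carrier[OF B] B det])
    then have g_ann: "annihilates g B" using B by (simp add: annihilates_def)
    have "degree g \<le> d - 1"
      by (rule degree_le) (auto simp: g_def coeff_sum coeff_poly_shift d_def coeff_eq_0)
    then have "g = 0" using g_ann m d by (auto simp: is_min_poly_def d_def)
    then show ?thesis
      using sum_smult_poly_shift_eq_0[OF monic] unfolding g_def d_def by blast
  qed
  have surj: "\<exists>C\<in>sl_mat n. b C = f" if deg: "degree f < d" and f0: "coeff f 0 = 0" for f
  proof -
    obtain w where w: "\<forall>k<d. (\<Sum>s\<in>?S. (N k * B) $$ s * w s) = coeff f k"
      using ex_dual_vector[where S = ?S and d = d and v = "\<lambda>k s. (N k * B) $$ s" and b = "coeff f"] indep by auto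
    \<comment> \<open>The indices are swapped because the trace of a product pairs entry (i, j) with
      entry (j, i).\<close>
    define C where "C = mat n n (\<lambda>(j, i). w (i, j))"
    have C: "C \<in> carrier_mat n n" by (simp add: C_def)
    have "b C = f"
    proof (rule poly_eqI)
      fix k
      show "coeff (b C) k = coeff f k"
      proof (cases "k < d")
        case True
        have "coeff (b C) k = (\<Sum>s\<in>?S. (N k * B) $$ s * w s)"
          unfolding coeff_b[OF C] mat_trace_mult[OF NB C]
          by (rule sum.cong) (auto simp: C_def)
        then show ?thesis using w True by simp
      next
        case False
        then show ?thesis using coeff_b_ge[OF C] deg by (simp add: coeff_eq_0)
      qed
    qed
    \<comment> \<open>The trace condition was not imposed on \<open>w\<close>: it follows from f(0)
      = 0, since m(0) is nonzero.\<close>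
    moreover have "mat_trace C = 0" using coeff_b_0[OF C] \<open>b C = f\<close> f0 m0 by simp
    ultimately show ?thesis using C by (auto simp: sl_mat_def)
  qed
  have "b ` sl_mat n = {f. degree f < d \<and> poly f 0 = 0}"
  proof (intro equalityI subsetI)
    fix f assume "f \<in> b ` sl_mat n"
    then obtain C where C: "C \<in> carrier_mat n n" and tr: "mat_trace C = 0" and f: "f = b C"
      by (auto simp: sl_mat_def)
    \<comment> \<open>The bound \<open>d - 1\<close> becomes the strict bound because
      \<open>d\<close> is positive.\<close>
    have "degree f \<le> d - 1" by (rule degree_le) (use coeff_b_ge[OF C] f in auto)
    then show "f \<in> {f. degree f < d \<and> poly f 0 = 0}"
      using d coeff_b_0[OF C] tr f by (simp add: poly_0_coeff_0)
  next
    fix f :: "'a poly" assume "f \<in> {f. degree f < d \<and> poly f 0 = 0}"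
    then show "f \<in> b ` sl_mat n" using surj[of f] by (auto simp: poly_0_coeff_0)
  qed
  moreover have "dchar B ` sl_mat n = (\<lambda>f. char_poly B div m * f) ` (b ` sl_mat n)"
    unfolding image_image by (rule image_cong) (auto simp: sl_mat_def dchar)
  ultimately show ?thesis unfolding m_def[symmetric] d_def by auto
qed

end
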